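(* Let $p\ge1$, let $Q\subseteq\{0,1\}^p$ be such that for every $i\in[p]$ there exists $z\in Q$ with $z_i=1$, and let $f:\mathbb{R}\to\mathbb{R}$ be convex with $f(0)=0$. Let $$Z_Q=\left\{(z,\beta,t)\in Q\times\mathbb{R}^p\times\mathbb{R}\;:\; f(\mathbf 1^\top\beta)\le t,\ \beta_i(1-z_i)=0\ \ \forall i\in[p]\right\}.$$ Let $V_1,\dots,V_k$ be the vertex sets of the connected components of the graph $G_Q$. For $\ell\in[k]$ let $Q_\ell=\{z\in Q: z_i=0\ \forall i\notin V_\ell\}\subseteq\{0,1\}^p$. For each $\ell$ let $\operatorname{conv}(Q_\ell)=\{z\in\mathbb{R}^p: A^\ell z\le\delta^\ell\}$ be a description by finitely many linear inequalities, and let $\mathcal F_\ell\subseteq\mathbb{R}^p$ be a finite set with $\operatorname{conv}(Q_\ell\setminus\{\mathbf 0\})=\operatorname{conv}(Q_\ell)\cap\{z:\pi^\top z\ge1\ \forall\pi\in\mathcal F_\ell\}$. Assume $\mathbf 0\in Q_\ell$ and $\mathcal F_\ell\neq\emptyset$ for all $\ell\in[k]$. Then $\operatorname{cl\,conv}(Z_Q)$ is the projection onto the $(z,\beta,t)$-space of the set of all $$(z,\beta,\hat z,\hat\beta,\alpha,\hat t,t)\in[0,1]^p\times\mathbb{R}^p\times[0,1]^{pk}\times\mathbb{R}^{pk}\times\mathbb{R}_+^k\times\mathbb{R}^k\times\mathbb{R},$$ with $\hat z=(\hat z^\ell)_{\ell\in[k]}$, $\hat\beta=(\hat\beta^\ell)_{\ell\in[k]}$,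 $\hat z^\ell,\hat\beta^\ell\in\mathbb{R}^p$, $\hat t=(\hat t^\ell)_{\ell\in[k]}$, satisfying $$\sum_{\ell=1}^k\alpha_\ell=1,\quad t=\sum_{\ell=1}^k\hat t^\ell,\quad z=\sum_{\ell=1}^k\hat z^\ell,\quad \beta=\sum_{\ell=1}^k\hat\beta^\ell,$$ and, for all $\ell\in[k]$, $$A^\ell\hat z^\ell\le\delta^\ell\alpha_\ell,\qquad \hat t^\ell\ge\alpha_\ell f\Big(\frac{\mathbf 1^\top\hat\beta^\ell}{\alpha_\ell}\Big),\qquad \hat t^\ell\ge(\pi^\top\hat z^\ell)f\Big(\frac{\mathbf 1^\top\hat\beta^\ell}{\pi^\top\hat z^\ell}\Big)\ \ \forall\pi\in\mathcal F_\ell.$$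
   Context: Notation: $[p]=\{1,\dots,p\}$; $\mathbf 0,\mathbf 1$ are the all-zeros and all-ones vectors; $\operatorname{conv}$ denotes convex hull and $\operatorname{cl\,conv}$ the closure of the convex hull. Graph $G_Q$: it has vertex set $[p]$, and for $i\ne j$, $\{i,j\}$ is an edge if and only if there exists $z\in Q$ with $z_i=z_j=1$. Convention for perspectives: for $w>0$ the expression $w f(x/w)$ is the usual one, and for $w=0$ it is understood as $0f(x/0):=\lim_{w\to0^+}w f(x/w)$ (possibly $+\infty$, in which case an inequality $t\ge+\infty$ is not satisfied by any real $t$).
   Formalization: The formal statement additionally requires that each copy β̂^ℓ vanish outside V_ℓ; without this the claim fails for k ≥ 2, e.g. Q={00,10,01}, f(s)=s², β̂^1=(1,-1), β̂^2=0, ẑ^ℓ=e_ℓ/2, α=(1/2,1/2), t̂=0. *)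

theory Defs
  imports "HOL-Analysis.Analysis"
begin

text \<open>
  The index set \<open>[p]\<close> is the universe of a finite type; types are nonempty, so \<open>p \<ge> 1\<close> is implicit.
  A set \<open>Q \<subseteq> {0,1}\<^sup>p\<close> is a set of real vectors all of whose entries are 0 or 1.
\<close>

definition binary_vectors :: "(real^'p::finite) set" where
  "binary_vectors = {z. \<forall>i. z $ i = 0 \<or> z $ i = 1}"

definition mixed_binary_set ::
    "(real^'p::finite) set \<Rightarrow> (real \<Rightarrow> real) \<Rightarrow> ((real^'p) \<times> (real^'p) \<times> real) set" where
  "mixed_binary_set Q f =
     {(z, \<beta>, t). z \<in> Q \<and> f (\<Sum>i\<in>UNIV. \<beta> $ i) \<le> t \<and> (\<forall>i. \<beta> $ i * (1 - z $ i) = 0)}"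

definition graph_edges :: "(real^'p::finite) set \<Rightarrow> ('p \<times> 'p) set" where
  "graph_edges Q = {(i, j). i \<noteq> j \<and> (\<exists>z\<in>Q. z $ i = 1 \<and> z $ j = 1)}"

text \<open>
  The edge relation is symmetric, so its reflexive transitive closure is the equivalence relation
  of being joined by a path, and its classes are the vertex sets of the connected components.
\<close>

definition graph_components :: "(real^'p::finite) set \<Rightarrow> 'p set set" where
  "graph_components Q = UNIV // (graph_edges Q)\<^sup>*"

definition restrict_support :: "(real^'p::finite) set \<Rightarrow> 'p set \<Rightarrow> (real^'p) set" where
  "restrict_support Q V = {z \<in> Q. \<forall>i. i \<notin> V \<longrightarrow> z $ i = 0}"

text \<open>
  \<open>perspective f w x\<close> is \<open>w f(x/w)\<close>, extended to \<open>w = 0\<close> by the limit from the right, which exists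
  in the extended reals when \<open>f\<close> is convex. The value at \<open>w < 0\<close> is irrelevant:
  in \<open>lifted_set\<close> below, \<open>w\<close> is \<open>\<alpha> l\<close> or \<open>\<pi> \<bullet> zh l\<close>, and when \<open>{z. \<forall>r<m l. A l r \<bullet> z \<le> \<delta> l r}\<close> is
  the hull of a set of binary vectors containing 0 with \<open>\<pi> \<bullet> z \<ge> 1\<close> at its nonzero members,
  all of these are nonnegative.
\<close>

definition perspective :: "(real \<Rightarrow> real) \<Rightarrow> real \<Rightarrow> real \<Rightarrow> ereal" where
  "perspective f w x =
     (if w = 0 then Lim (at_right 0) (\<lambda>u. ereal (u * f (x / u))) else ereal (w * f (x / w)))"

text \<open>
  A family indexed by \<open>l \<in> {1..k}\<close> is a function on \<open>nat\<close>, of which only the values there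
  matter. The system \<open>A\<^sup>l z \<le> \<delta>\<^sup>l\<close> has \<open>m l\<close> rows; row \<open>r < m l\<close> is \<open>A l r \<bullet> z \<le> \<delta> l r\<close>.

  The condition that \<open>bh l\<close> vanishes off \<open>V l\<close> (as \<open>zh l\<close> does by its linear system) is needed as
  soon as there are two components. For \<open>Q = {(0,0), (1,0), (0,1)}\<close> and \<open>f s = s\<^sup>2\<close>, every point of
  \<open>closure (convex hull (mixed_binary_set Q f))\<close> satisfies \<open>t \<ge> (\<beta> $ 1)\<^sup>2 + (\<beta> $ 2)\<^sup>2\<close>; without the
  condition, \<open>bh 1 = (1,-1)\<close>, \<open>bh 2 = 0\<close>, \<open>\<alpha> = (1/2,1/2)\<close> and \<open>th = 0\<close> would be admissible, projecting
  to \<open>z = (1/2,1/2)\<close>, \<open>\<beta> = (1,-1)\<close>, \<open>t = 0\<close>.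
\<close>

definition lifted_set ::
    "nat \<Rightarrow> (nat \<Rightarrow> 'p set) \<Rightarrow> (nat \<Rightarrow> nat) \<Rightarrow> (nat \<Rightarrow> nat \<Rightarrow> real^'p::finite) \<Rightarrow> (nat \<Rightarrow> nat \<Rightarrow> real) \<Rightarrow>
     (nat \<Rightarrow> (real^'p) set) \<Rightarrow> (real \<Rightarrow> real) \<Rightarrow>
     ((real^'p) \<times> (real^'p) \<times> (nat \<Rightarrow> real^'p) \<times> (nat \<Rightarrow> real^'p) \<times> (nat \<Rightarrow> real) \<times> (nat \<Rightarrow> real) \<times> real) set"
  where
  "lifted_set k V m A \<delta> F f =
     {(z, \<beta>, zh, bh, \<alpha>, th, t).
        z \<in> cbox 0 1 \<and>
        (\<forall>l\<in>{1..k}. zh l \<in> cbox 0 1) \<and>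
        (\<forall>l\<in>{1..k}. 0 \<le> \<alpha> l) \<and>
        (\<Sum>l=1..k. \<alpha> l) = 1 \<and>
        t = (\<Sum>l=1..k. th l) \<and>
        z = (\<Sum>l=1..k. zh l) \<and>
        \<beta> = (\<Sum>l=1..k. bh l) \<and>
        (\<forall>l\<in>{1..k}.
           (\<forall>i. i \<notin> V l \<longrightarrow> bh l $ i = 0) \<and>
           (\<forall>r<m l. A l r \<bullet> zh l \<le> \<delta> l r * \<alpha> l) \<and>
           ereal (th l) \<ge> perspective f (\<alpha> l) (\<Sum>i\<in>UNIV. bh l $ i) \<and>
           (\<forall>\<pi>\<in>F l. ereal (th l) \<ge> perspective f (\<pi> \<bullet> zh l) (\<Sum>i\<in>UNIV. bh l $ i)))}"

end

theory Submission
  imports Defs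
begin

text \<open>
  Write \<open>C\<close> for the closed convex hull of the mixed-binary set. The support of a point of \<open>Q\<close> is a
  clique of the graph, so every \<open>z \<in> Q\<close> lies in one of the sets \<open>Q\<^sub>l\<close>, and \<open>C\<close> is the closed convex
  hull of a union over the components. The extended formulation is the disjunctive formulation of that
  union, and the theorem splits into two inclusions.

  \<^emph>\<open>The hull lies in the projection.\<close> It suffices that the projection contains the mixed-binary set
  and is convex and closed. A convex \<open>f\<close> is the supremum of its affine minorants \<open>a y + b\<close>, so the
  nonlinear condition that \<open>\<tau>\<close> bounds the perspective of \<open>f\<close> at weight \<open>w \<ge> 0\<close> is the
  infinite linear system \<open>a x + b w \<le> \<tau>\<close> (\<open>perspective_le_iff\<close>). This covers \<open>w = 0\<close> too,
  because \<open>f 0 = 0\<close> forces \<open>b \<le> 0\<close>, and it makes convexity immediate. Closedness is a compactness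
  argument: in a convergent sequence of projected points, each lifted variable is either determined by
  the point (\<open>bh l\<close> is the part of \<open>\<beta>\<close> on \<open>V l\<close>) or bounded, so a subsequence of the lifts converges.

  \<^emph>\<open>The projection lies in the hull.\<close> Let \<open>W\<close> be the least of \<open>\<alpha> l\<close> and the numbers \<open>\<pi> \<bullet> zh l\<close>. The
  perspective decreases in its weight, so all constraints on \<open>th l\<close> together say that \<open>th l\<close> bounds the
  perspective at weight \<open>W\<close>. The inequalities \<open>\<pi> \<bullet> z \<ge> 1\<close> cut out the hull of the nonzero members
  of \<open>Q\<^sub>l\<close>, which makes \<open>zh l\<close> exactly \<open>W\<close> times a point of that hull. Each summand
  \<open>(zh l, bh l, th l)\<close> is therefore \<open>W\<close> times a point of \<open>C\<close> plus a recession direction of \<open>C\<close>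
  (\<open>lifted_piece_decomposition\<close>). Since the weights sum to at most 1 and \<open>0 \<in> C\<close>, the sum is in \<open>C\<close>.

  Connectedness supplies the recession directions. If \<open>z \<in> Q\<close> has two entries \<open>i\<close> and \<open>j\<close> equal to 1,
  then \<open>\<beta>\<close> may be any multiple of the difference of the unit vectors at \<open>j\<close> and \<open>i\<close>, at cost
  \<open>f 0 = 0\<close>. Along paths these differences generate every vector on \<open>V l\<close> with entries summing to 0,
  so only the sum of the entries of \<open>bh l\<close> matters.
\<close>

section \<open>Perspectives and affine minorants\<close>

definition affine_minorants :: "(real \<Rightarrow> real) \<Rightarrow> (real \<times> real) set" where
  "affine_minorants f = {(a, b). \<forall>y. a * y + b \<le> f y}"

lemma supporting_line:
  fixes f :: "real \<Rightarrow> real"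
  assumes "convex_on UNIV f"
  obtains a where "\<And>y. f x + a * (y - x) \<le> f y"
proof
  show "f x + Inf ((\<lambda>t. (f x - f t) / (x - t)) ` ({x<..} \<inter> UNIV)) * (y - x) \<le> f y" for y
    using convex_le_Inf_differential[OF assms, of x y] by simp
qed

text \<open>
  A supporting line of \<open>f\<close> at \<open>x / w\<close> is a minorant that attains the value \<open>w f(x / w)\<close>.
\<close>

lemma perspective_le_iff_pos:
  assumes "convex_on UNIV f" "w > 0"
  shows "w * f (x / w) \<le> \<tau> \<longleftrightarrow> (\<forall>(a, b)\<in>affine_minorants f. a * x + b * w \<le> \<tau>)"
proof safe
  fix a b assume le: "w * f (x / w) \<le> \<tau>" and "(a, b) \<in> affine_minorants f"
  then have "a * (x / w) + b \<le> f (x / w)"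
    unfolding affine_minorants_def by blast
  then have "w * (a * (x / w) + b) \<le> w * f (x / w)"
    using assms by (intro mult_left_mono) auto
  moreover have "w * (a * (x / w) + b) = a * x + b * w"
    using assms by (simp add: field_simps)
  ultimately show "a * x + b * w \<le> \<tau>"
    using le by linarith
next
  assume *: "\<forall>(a, b)\<in>affine_minorants f. a * x + b * w \<le> \<tau>"
  obtain a where a: "\<And>y. f (x / w) + a * (y - x / w) \<le> f y"
    using supporting_line[OF assms(1)] by blast
  have "(a, f (x / w) - a * (x / w)) \<in> affine_minorants f"
    using a by (auto simp: affine_minorants_def algebra_simps)
  from *[rule_format, OF this] show "w * f (x / w) \<le> \<tau>"
    using assms(2) by (simp add: field_simps)
qed

lemma affine_minorant_at_0:
  assumes "f 0 = 0" "(a, b) \<in> affine_minorants f"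
  shows "b \<le> 0"
  using assms(2)[unfolded affine_minorants_def, simplified, rule_format, of 0] assms(1) by simp

text \<open>
  The constant terms of the minorants are nonpositive, so each \<open>a x + b w\<close> decreases in \<open>w\<close>, and so
  does the supremum of all of them.
\<close>

lemma perspective_antimono:
  assumes "convex_on UNIV f" "f 0 = 0" "0 < u" "u \<le> w"
  shows "w * f (x / w) \<le> u * f (x / u)"
proof -
  have "w > 0" using assms by simp
  have "a * x + b * w \<le> u * f (x / u)" if ab: "(a, b) \<in> affine_minorants f" for a b
  proof -
    have "a * x + b * u \<le> u * f (x / u)"
      using perspective_le_iff_pos[OF assms(1,3), of x "u * f (x / u)"] ab by auto
    moreover have "b * w \<le> b * u"
      using affine_minorant_at_0[OF assms(2) ab] assms by (intro mult_left_mono_neg) auto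
    ultimately show ?thesis by simp
  qed
  then show ?thesis
    using perspective_le_iff_pos[OF assms(1) \<open>w > 0\<close>] by auto
qed

text \<open>By monotonicity the limit from the right is a supremum; in particular it exists.\<close>

lemma perspective_at_0:
  assumes "convex_on UNIV f" "f 0 = 0"
  shows "perspective f 0 x = (SUP u\<in>{0<..}. ereal (u * f (x / u)))" (is "_ = ?S")
proof -
  have "((\<lambda>u. ereal (u * f (x / u))) \<longlongrightarrow> ?S) (at_right 0)"
  proof (rule order_tendstoI)
    fix c assume "c < ?S"
    then obtain w where w: "w > 0" "c < ereal (w * f (x / w))"
      by (auto simp: less_SUP_iff)
    have "c < ereal (u * f (x / u))" if "0 < u" "u < w" for u
      using w perspective_antimono[OF assms, of u w x] that
      by (meson ereal_less_eq(3) less_imp_le order_less_le_trans)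
    then show "\<forall>\<^sub>F u in at_right 0. c < ereal (u * f (x / u))"
      using w(1) by (auto simp: eventually_at_right_field)
  next
    fix c assume c: "?S < c"
    have "ereal (u * f (x / u)) < c" if "0 < u" for u
      using that by (intro order_le_less_trans[OF SUP_upper c]) auto
    then show "\<forall>\<^sub>F u in at_right 0. ereal (u * f (x / u)) < c"
      by (auto simp: eventually_at_right_field intro: exI[of _ 1])
  qed
  then show ?thesis
    by (simp add: perspective_def tendsto_Lim)
qed

text \<open>
  The epigraph of the perspective, with its value at weight 0, is an intersection of halfspaces.
  Closedness, convexity and the description of the recession directions all rest on this.
\<close>

lemma perspective_le_iff:
  assumes "convex_on UNIV f" "f 0 = 0" "w \<ge> 0"
  shows "perspective f w x \<le> ereal \<tau> \<longleftrightarrow> (\<forall>(a, b)\<in>affine_minorants f. a * x + b * w \<le> \<tau>)"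
proof (cases "w = 0")
  case False
  then show ?thesis
    using perspective_le_iff_pos[OF assms(1)] assms(3) by (simp add: perspective_def)
next
  case True
  have "perspective f 0 x \<le> ereal \<tau> \<longleftrightarrow>
      (\<forall>(a, b)\<in>affine_minorants f. \<forall>u>0. a * x + b * u \<le> \<tau>)"
    using perspective_le_iff_pos[OF assms(1)]
    by (auto simp: perspective_at_0[OF assms(1,2)] SUP_le_iff)
  moreover have "(\<forall>u>0. a * x + b * u \<le> \<tau>) \<longleftrightarrow> a * x \<le> \<tau>"
    if "(a, b) \<in> affine_minorants f" for a b
  proof -
    have b: "b \<le> 0" by (rule affine_minorant_at_0[OF assms(2) that])
    have "a * x \<le> \<tau>" if *: "\<forall>u>0. a * x + b * u \<le> \<tau>"
    proof (rule tendsto_upperbound)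
      have "((\<lambda>u. a * x + b * u) \<longlongrightarrow> a * x + b * 0) (at_right 0)"
        by (intro tendsto_intros)
      then show "((\<lambda>u. a * x + b * u) \<longlongrightarrow> a * x) (at_right 0)" by simp
      show "\<forall>\<^sub>F u in at_right 0. a * x + b * u \<le> \<tau>"
        using * by (auto simp: eventually_at_right_field intro: exI[of _ 1])
    qed simp
    moreover have "a * x + b * u \<le> \<tau>" if "a * x \<le> \<tau>" "u > 0" for u
    proof -
      have "b * u \<le> 0" using b that by (simp add: mult_nonpos_nonneg)
      then show ?thesis using that by linarith
    qed
    ultimately show ?thesis by blast
  qed
  ultimately have "perspective f 0 x \<le> ereal \<tau> \<longleftrightarrow> (\<forall>(a, b)\<in>affine_minorants f. a * x \<le> \<tau>)"
    by (simp add: split_beta)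
  then show ?thesis
    using True by simp
qed

section \<open>Recession directions of closed convex sets\<close>

text \<open>
  For a nonempty closed convex set this is the recession cone; asking only for a single step
  \<open>c + d\<close> is then equivalent to asking for all multiples \<open>c + s d\<close> with \<open>s \<ge> 0\<close>.
\<close>

definition recession_directions :: "'a::real_vector set \<Rightarrow> 'a set" where
  "recession_directions C = {d. \<forall>c\<in>C. c + d \<in> C}"

lemma recession_directions_0: "0 \<in> recession_directions C"
  by (simp add: recession_directions_def)

lemma recession_directions_add:
  "d \<in> recession_directions C \<Longrightarrow> e \<in> recession_directions C \<Longrightarrow> d + e \<in> recession_directions C"
  by (auto simp: recession_directions_def add.assoc[symmetric])

lemma recession_directions_sum:
  "(\<And>i. i \<in> I \<Longrightarrow> d i \<in> recession_directions C) \<Longrightarrow> (\<Sum>i\<in>I. d i) \<in> recession_directions C"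
  by (induction I rule: infinite_finite_induct)
    (auto intro: recession_directions_0 recession_directions_add)

text \<open>
  The recession cone consists of the limits of \<open>u y\<close> with \<open>u\<close> tending to 0 and \<open>y \<in> C\<close>; here \<open>g u\<close>
  is \<open>u y\<close>. The reason is that \<open>(1 - u) c + u y\<close> stays in \<open>C\<close>.
\<close>

lemma recession_direction_limit:
  fixes C :: "'a::real_normed_vector set"
  assumes "closed C" "convex C"
    and g: "\<And>u. 0 < u \<Longrightarrow> (1 / u) *\<^sub>R g u \<in> C"
    and lim: "(g \<longlongrightarrow> d) (at_right (0::real))"
  shows "d \<in> recession_directions C"
  unfolding recession_directions_def
proof safe
  fix c assume c: "c \<in> C"
  have "((\<lambda>u. (1 - u) *\<^sub>R c + g u) \<longlongrightarrow> (1 - 0) *\<^sub>R c + d) (at_right 0)"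
    by (intro tendsto_intros lim)
  moreover have "(1 - u) *\<^sub>R c + g u \<in> C" if "0 < u" "u < 1" for u
    using convexD[OF assms(2) c g[OF that(1)], of "1 - u" u] that by simp
  then have "\<forall>\<^sub>F u in at_right 0. (1 - u) *\<^sub>R c + g u \<in> C"
    by (auto simp: eventually_at_right_field intro: exI[of _ 1])
  ultimately have "(1 - 0) *\<^sub>R c + d \<in> C"
    by (intro Lim_in_closed_set[OF assms(1)]) auto
  then show "c + d \<in> C" by simp
qed

lemma subconvex_combination_plus_recession:
  fixes c d :: "'i \<Rightarrow> 'a::real_vector"
  assumes "convex C" "0 \<in> C" "finite I" "sum W I \<le> 1"
    and "\<And>i. i \<in> I \<Longrightarrow> 0 \<le> W i" "\<And>i. i \<in> I \<Longrightarrow> c i \<in> C"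
    and d: "\<And>i. i \<in> I \<Longrightarrow> d i \<in> recession_directions C"
  shows "(\<Sum>i\<in>I. W i *\<^sub>R c i + d i) \<in> C"
proof -
  \<comment> \<open>The index \<open>None\<close> carries the missing weight, which goes to the point 0.\<close>
  have "(\<Sum>i\<in>insert None (Some ` I).
      (case i of None \<Rightarrow> 1 - sum W I | Some i \<Rightarrow> W i) *\<^sub>R (case i of None \<Rightarrow> 0 | Some i \<Rightarrow> c i)) \<in> C"
    using assms by (intro convex_sum) (auto simp: sum.reindex)
  then have "(\<Sum>i\<in>I. W i *\<^sub>R c i) \<in> C"
    using assms(3) by (simp add: sum.reindex)
  moreover have "(\<Sum>i\<in>I. d i) \<in> recession_directions C"
    using d by (rule recession_directions_sum)
  ultimately show ?thesis
    by (simp add: recession_directions_def sum.distrib)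
qed

text \<open>
  Bolzano--Weierstrass for finitely many bounded sequences at once, by refining the subsequence for one
  index after the other.
\<close>

lemma finite_family_convergent_subsequence:
  fixes s :: "nat \<Rightarrow> 'i \<Rightarrow> 'a::heine_borel"
  assumes "finite I" "\<And>i. i \<in> I \<Longrightarrow> bounded (range (\<lambda>n. s n i))"
  shows "\<exists>r y. strict_mono r \<and> (\<forall>i\<in>I. (\<lambda>n. s (r n) i) \<longlonglongrightarrow> y i)"
  using assms
proof (induction I)
  case empty
  show ?case by (auto intro: exI[of _ id] simp: strict_mono_id)
next
  case (insert j I)
  then obtain r y where r: "strict_mono r" "\<forall>i\<in>I. (\<lambda>n. s (r n) i) \<longlonglongrightarrow> y i"
    by auto
  have "bounded (range (\<lambda>n. s (r n) j))"
    by (rule bounded_subset[OF insert.prems[of j]]) auto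
  then obtain l q where q: "strict_mono q" "((\<lambda>n. s (r n) j) \<circ> q) \<longlonglongrightarrow> l"
    using bounded_imp_convergent_subsequence by blast
  have "(\<lambda>n. s (r (q n)) i) \<longlonglongrightarrow> (y(j := l)) i" if "i \<in> insert j I" for i
    using q r LIMSEQ_subseq_LIMSEQ[of "\<lambda>n. s (r n) i" "y i" q] that insert.hyps
    by (auto simp: o_def)
  then show ?case
    using strict_mono_o[OF r(1) q(1)] unfolding o_def by blast
qed

section \<open>Connected components and supports\<close>

lemma sym_graph_edges: "sym (graph_edges Q)"
  by (auto simp: graph_edges_def sym_def)

locale component_decomposition =
  fixes Q :: "(real^'p::finite) set"
    and f :: "real \<Rightarrow> real"
    and k :: nat
    and V :: "nat \<Rightarrow> 'p set"
    and m :: "nat \<Rightarrow> nat"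
    and A :: "nat \<Rightarrow> nat \<Rightarrow> real^'p"
    and \<delta> :: "nat \<Rightarrow> nat \<Rightarrow> real"
    and F :: "nat \<Rightarrow> (real^'p) set"
  assumes binary: "Q \<subseteq> binary_vectors"
    and cover: "\<And>i. \<exists>z\<in>Q. z $ i = 1"
    and convex_f: "convex_on UNIV f"
    and f_0: "f 0 = 0"
    and components: "bij_betw V {1..k} (graph_components Q)"
    and hull: "\<And>l. l \<in> {1..k} \<Longrightarrow>
           convex hull (restrict_support Q (V l)) = {z. \<forall>r<m l. A l r \<bullet> z \<le> \<delta> l r}"
    and finite_F: "\<And>l. l \<in> {1..k} \<Longrightarrow> finite (F l)"
    and hull_nonzero: "\<And>l. l \<in> {1..k} \<Longrightarrow>
           convex hull (restrict_support Q (V l) - {0}) =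
             convex hull (restrict_support Q (V l)) \<inter> {z. \<forall>\<pi>\<in>F l. \<pi> \<bullet> z \<ge> 1}"
    and zero_mem: "\<And>l. l \<in> {1..k} \<Longrightarrow> 0 \<in> restrict_support Q (V l)"
begin

(* Keeps the index set in the form {1..k}, in which the hypotheses are stated. *)
declare One_nat_def [simp del]

abbreviation "S l \<equiv> restrict_support Q (V l)"
abbreviation "C \<equiv> closure (convex hull (mixed_binary_set Q f))"

lemma equiv_connected: "equiv UNIV ((graph_edges Q)\<^sup>*)"
  by (simp add: equiv_def refl_rtrancl sym_rtrancl sym_graph_edges trans_rtrancl)

lemma V_quotient: "l \<in> {1..k} \<Longrightarrow> V l \<in> UNIV // (graph_edges Q)\<^sup>*"
  using components unfolding bij_betw_def graph_components_def by blast

lemma V_nonempty: "l \<in> {1..k} \<Longrightarrow> V l \<noteq> {}"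
  using in_quotient_imp_non_empty[OF equiv_connected V_quotient] .

lemma V_connected: "l \<in> {1..k} \<Longrightarrow> i \<in> V l \<Longrightarrow> j \<in> V l \<Longrightarrow> (i, j) \<in> (graph_edges Q)\<^sup>*"
  using in_quotient_imp_in_rel[OF equiv_connected V_quotient] by auto

lemma V_closed: "l \<in> {1..k} \<Longrightarrow> i \<in> V l \<Longrightarrow> (i, j) \<in> graph_edges Q \<Longrightarrow> j \<in> V l"
  using in_quotient_imp_closed[OF equiv_connected V_quotient] by blast

lemma mem_V_iff: "i \<in> V l' \<longleftrightarrow> l' = l" if "l \<in> {1..k}" "i \<in> V l" "l' \<in> {1..k}"
proof
  assume "i \<in> V l'"
  then have "V l' = V l"
    using quotient_disj[OF equiv_connected V_quotient[OF that(1)] V_quotient[OF that(3)]] that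
    by auto
  then show "l' = l"
    using bij_betw_imp_inj_on[OF components] that(1,3) by (meson inj_onD)
qed (use that in simp)

lemma V_cover: "\<exists>l\<in>{1..k}. i \<in> V l"
proof -
  have "i \<in> \<Union>(V ` {1..k})"
    using components Union_quotient[OF equiv_connected]
    by (simp add: bij_betw_def graph_components_def)
  then show ?thesis by auto
qed

definition block :: "nat \<Rightarrow> real^'p \<Rightarrow> real^'p" where
  "block l x = (\<chi> i. if i \<in> V l then x $ i else 0)"

lemma sum_block: "(\<Sum>i\<in>UNIV. block l x $ i) = (\<Sum>i\<in>V l. x $ i)"
  by (simp add: block_def sum.If_cases)

lemma sum_blocks: "(\<Sum>l=1..k. block l x) = x"
proof (rule vec_eq_iff[THEN iffD2, OF allI])
  fix i
  obtain l0 where l0: "l0 \<in> {1..k}" "i \<in> V l0"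
    using V_cover by blast
  have "(\<Sum>l=1..k. block l x) $ i = (\<Sum>l=1..k. if l = l0 then x $ i else 0)"
    unfolding sum_component block_def by (intro sum.cong) (simp_all add: mem_V_iff[OF l0])
  also have "\<dots> = x $ i"
    using l0(1) by simp
  finally show "(\<Sum>l=1..k. block l x) $ i = x $ i" .
qed

text \<open>
  The components partition the coordinates, so a sum of vectors supported on different components
  determines its summands. This makes \<open>bh\<close> a function of \<open>\<beta>\<close> in the lifted set.
\<close>

lemma supported_sum_eq_block:
  assumes "x = (\<Sum>l=1..k. y l)" "\<And>l i. l \<in> {1..k} \<Longrightarrow> i \<notin> V l \<Longrightarrow> y l $ i = 0" "l \<in> {1..k}"
  shows "y l = block l x"
proof (rule vec_eq_iff[THEN iffD2, OF allI])
  fix i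
  have "x $ i = (\<Sum>l'=1..k. if l' = l then y l $ i else 0)" if "i \<in> V l"
    unfolding assms(1) sum_component
    using assms(2) by (intro sum.cong) (simp_all add: mem_V_iff[OF assms(3) that])
  then show "y l $ i = block l x $ i"
    using assms(2,3) by (auto simp: block_def)
qed

lemma binaryD: "z \<in> Q \<Longrightarrow> z $ i \<noteq> 0 \<Longrightarrow> z $ i = 1"
  using binary by (auto simp: binary_vectors_def)

text \<open>The support of a member of \<open>Q\<close> is a clique, so it cannot leave a component that it meets.\<close>

lemma mem_S: "z \<in> S l" if "z \<in> Q" "z $ i = 1" "i \<in> V l" "l \<in> {1..k}"
proof -
  have "j \<in> V l" if "z $ j \<noteq> 0" for j
  proof (cases "j = i")
    case False
    then have "(i, j) \<in> graph_edges Q"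
      using that \<open>z \<in> Q\<close> \<open>z $ i = 1\<close> binaryD by (auto simp: graph_edges_def)
    then show ?thesis
      using V_closed \<open>i \<in> V l\<close> \<open>l \<in> {1..k}\<close> by blast
  qed (use \<open>i \<in> V l\<close> in simp)
  then show ?thesis
    using \<open>z \<in> Q\<close> by (auto simp: restrict_support_def)
qed

lemma S_cover: "\<exists>l\<in>{1..k}. z \<in> S l" if "z \<in> Q"
proof (cases "z = 0")
  case True
  then show ?thesis
    using V_cover zero_mem by blast
next
  case False
  then obtain i where "z $ i \<noteq> 0"
    by (auto simp: vec_eq_iff)
  then show ?thesis
    using V_cover[of i] mem_S[OF that binaryD[OF that]] by blast
qed

lemma S_subset_cbox: "S l \<subseteq> cbox 0 1"
proof
  fix z assume "z \<in> S l"
  then have "z $ i = 0 \<or> z $ i = 1" for i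
    using binaryD by (auto simp: restrict_support_def)
  then have "0 \<le> z $ i \<and> z $ i \<le> 1" for i
    by (metis order_refl zero_le_one)
  then show "z \<in> cbox 0 1"
    by (simp add: mem_box_cart)
qed

lemma nonzero_S_nonempty: "S l - {0} \<noteq> {}" if l: "l \<in> {1..k}"
proof -
  obtain i where i: "i \<in> V l"
    using V_nonempty[OF l] by blast
  obtain z where "z \<in> Q" "z $ i = 1"
    using cover by blast
  then show ?thesis
    using mem_S[OF _ _ i l] by force
qed

section \<open>Multiples of points in the hulls\<close>

text \<open>
  The homogeneous system describes the recession cone of a bounded polyhedron. It forces \<open>zh l = 0\<close>
  when \<open>\<alpha> l = 0\<close>.
\<close>

lemma homogeneous_system_imp_zero:
  assumes l: "l \<in> {1..k}" and x: "\<forall>r<m l. A l r \<bullet> x \<le> 0"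
  shows "x = 0"
proof (rule ccontr)
  assume "x \<noteq> 0"
  have "0 \<in> convex hull (S l)"
    using zero_mem[OF l] by (rule hull_inc)
  then have "0 \<le> \<delta> l r" if "r < m l" for r
    using that by (auto simp: hull[OF l])
  moreover have "A l r \<bullet> (c *\<^sub>R x) \<le> 0" if "c \<ge> 0" "r < m l" for c r
    using x that by (auto simp: mult_nonneg_nonpos)
  ultimately have mem: "c *\<^sub>R x \<in> convex hull (S l)" if "c \<ge> 0" for c
    using that unfolding hull[OF l] by force
  have "bounded (S l)"
    using bounded_subset[OF bounded_cbox S_subset_cbox] .
  then obtain B where B: "B > 0" "\<And>y. y \<in> convex hull (S l) \<Longrightarrow> norm y \<le> B"
    using bounded_convex_hull bounded_pos by metis
  from B(2)[OF mem[of "(B + 1) / norm x"]] B(1) \<open>x \<noteq> 0\<close> show False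
    by simp
qed

text \<open>
  Split off the vertex 0: a point of the hull of \<open>Q\<^sub>l\<close> is a convex combination of 0 and a point of the
  hull of the nonzero members.
\<close>

lemma scaled_hull_cases:
  assumes l: "l \<in> {1..k}" and "\<alpha> \<ge> 0" and x: "\<forall>r<m l. A l r \<bullet> x \<le> \<delta> l r * \<alpha>"
  obtains \<mu> q where "0 \<le> \<mu>" "\<mu> \<le> \<alpha>" "q \<in> convex hull (S l - {0})" "x = \<mu> *\<^sub>R q"
proof (cases "\<alpha> = 0")
  case True
  then have "x = 0"
    using homogeneous_system_imp_zero[OF l] x by simp
  moreover obtain q where "q \<in> S l - {0}"
    using nonzero_S_nonempty[OF l] by blast
  ultimately show ?thesis
    using that[of 0 q] assms(2) by (simp add: hull_inc)
next
  case False
  with assms have \<alpha>: "\<alpha> > 0" by simp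
  have "A l r \<bullet> (x /\<^sub>R \<alpha>) \<le> \<delta> l r" if "r < m l" for r
    using x[rule_format, OF that] \<alpha> by (simp add: divide_simps)
  then have "x /\<^sub>R \<alpha> \<in> convex hull (insert 0 (S l - {0}))"
    unfolding insert_Diff[OF zero_mem[OF l]] hull[OF l] by simp
  then obtain u v q where "0 \<le> u" "0 \<le> v" "u + v = 1" "q \<in> convex hull (S l - {0})"
      "x /\<^sub>R \<alpha> = v *\<^sub>R q"
    unfolding convex_hull_insert[OF nonzero_S_nonempty[OF l]] by auto
  moreover from this have "x = (\<alpha> * v) *\<^sub>R q"
    using \<alpha> by (metis divideR_right order_less_irrefl scaleR_scaleR)
  ultimately show ?thesis
    using that[of "\<alpha> * v" q] \<alpha> by (simp add: mult_left_le)
qed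

lemma scaled_hull_inner_nonneg:
  assumes "l \<in> {1..k}" "\<alpha> \<ge> 0" "\<forall>r<m l. A l r \<bullet> x \<le> \<delta> l r * \<alpha>" "\<pi> \<in> F l"
  shows "0 \<le> \<pi> \<bullet> x"
proof -
  obtain \<mu> q where "0 \<le> \<mu>" "q \<in> convex hull (S l - {0})" "x = \<mu> *\<^sub>R q"
    using scaled_hull_cases[OF assms(1-3)] .
  moreover from this have "1 \<le> \<pi> \<bullet> q"
    using hull_nonzero[OF assms(1)] assms(4) by blast
  ultimately show ?thesis
    by simp
qed

text \<open>
  In \<open>x = \<mu> q\<close> from the previous splitting, \<open>\<pi> \<bullet> q \<ge> 1\<close> gives \<open>\<mu> \<le> W\<close>. Hence \<open>x / W\<close> lies on the
  segment from 0 to \<open>q\<close>, and by the choice of \<open>W\<close> it satisfies all the inequalities \<open>\<pi> \<bullet> z \<ge> 1\<close> that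
  cut the hull of the nonzero members out of the whole hull. So \<open>W\<close> is the largest total weight that
  nonzero members can have in a representation of \<open>x\<close>.
\<close>

lemma scaled_hull_effective_weight:
  assumes l: "l \<in> {1..k}" and \<alpha>: "\<alpha> \<ge> 0" and x: "\<forall>r<m l. A l r \<bullet> x \<le> \<delta> l r * \<alpha>"
  defines "W \<equiv> Min (insert \<alpha> ((\<lambda>\<pi>. \<pi> \<bullet> x) ` F l))"
  shows "0 \<le> W" "W \<le> \<alpha>" "W = 0 \<Longrightarrow> x = 0" "W > 0 \<Longrightarrow> x /\<^sub>R W \<in> convex hull (S l - {0})"
proof -
  obtain \<mu> q where \<mu>: "0 \<le> \<mu>" "\<mu> \<le> \<alpha>" and q: "q \<in> convex hull (S l - {0})" and xq: "x = \<mu> *\<^sub>R q"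
    using scaled_hull_cases[OF l \<alpha> x] .
  have fin: "finite (insert \<alpha> ((\<lambda>\<pi>. \<pi> \<bullet> x) ` F l))"
    using finite_F[OF l] by simp
  have "\<mu> \<le> \<pi> \<bullet> x" if "\<pi> \<in> F l" for \<pi>
  proof -
    have "1 \<le> \<pi> \<bullet> q"
      using q hull_nonzero[OF l] that by blast
    then show ?thesis
      using mult_left_mono[of 1 "\<pi> \<bullet> q" \<mu>] \<mu>(1) xq by simp
  qed
  then have \<mu>W: "\<mu> \<le> W"
    using fin \<mu>(2) by (auto simp: W_def)
  show "0 \<le> W" "W \<le> \<alpha>"
    using \<mu>W \<mu>(1) fin by (auto simp: W_def)
  show "x = 0" if "W = 0"
    using \<mu>W \<mu>(1) xq that by simp
  show "x /\<^sub>R W \<in> convex hull (S l - {0})" if "W > 0"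
  proof -
    have W\<pi>: "W \<le> \<pi> \<bullet> x" if "\<pi> \<in> F l" for \<pi>
      using fin that by (simp add: W_def)
    have "1 \<le> \<pi> \<bullet> (x /\<^sub>R W)" if "\<pi> \<in> F l" for \<pi>
      using W\<pi>[OF that] \<open>W > 0\<close> by (simp add: divide_simps)
    moreover have "x /\<^sub>R W \<in> convex hull (S l)"
    proof -
      have "q \<in> convex hull (S l)" "0 \<in> convex hull (S l)"
        using q hull_mono[of "S l - {0}" "S l"] zero_mem[OF l] by (auto intro: hull_inc)
      then have "(\<mu> / W) *\<^sub>R q + (1 - \<mu> / W) *\<^sub>R 0 \<in> convex hull (S l)"
        using \<mu>(1) \<mu>W \<open>W > 0\<close> by (intro convexD convex_convex_hull) auto
      then show ?thesis
        by (simp add: xq divide_inverse mult.commute)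
    qed
    ultimately show ?thesis
      using hull_nonzero[OF l] by blast
  qed
qed

section \<open>Points and recession directions of the closed convex hull\<close>

lemma mem_C: "(z, \<beta>, t) \<in> mixed_binary_set Q f \<Longrightarrow> (z, \<beta>, t) \<in> C"
  by (meson closure_subset hull_subset subsetD)

lemma convex_C: "convex C"
  by (intro convex_closure convex_convex_hull)

lemma zero_mem_C: "0 \<in> C"
proof -
  obtain l where "l \<in> {1..k}"
    using V_cover by blast
  then have "0 \<in> Q"
    using zero_mem[of l] by (simp add: restrict_support_def)
  then show ?thesis
    using mem_C[of 0 0 0] by (simp add: mixed_binary_set_def f_0 zero_prod_def)
qed

lemma axis_mem_C: "(q, axis i s, \<tau>) \<in> C" if "q \<in> Q" "q $ i = 1" "f s \<le> \<tau>"
  using that by (intro mem_C) (auto simp: mixed_binary_set_def axis_def)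

lemma scaleR_axis_real: "c *\<^sub>R axis i (s::real) = axis i (c * s)"
  by (simp add: vec_eq_iff axis_def)

text \<open>
  For an edge there is \<open>q \<in> Q\<close> with both entries 1, and arbitrarily large opposite entries of \<open>\<beta>\<close> at
  the two ends leave the argument of \<open>f\<close> at 0.
\<close>

lemma recession_edge:
  assumes "(i, j) \<in> graph_edges Q"
  shows "(0, axis j s - axis i s, 0) \<in> recession_directions C"
proof -
  obtain q where q: "i \<noteq> j" "q \<in> Q" "q $ i = 1" "q $ j = 1"
    using assms by (auto simp: graph_edges_def)
  have *: "(q, axis j c - axis i c, 0) \<in> C" for c
    using q by (intro mem_C) (auto simp: mixed_binary_set_def axis_def sum_subtractf f_0)
  show ?thesis
  proof (rule recession_direction_limit[OF closed_closure convex_C])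
    fix u :: real assume "0 < u"
    then show "(1 / u) *\<^sub>R (u *\<^sub>R q, axis j s - axis i s, 0) \<in> C"
      using *[of "s / u"] by (simp add: scaleR_diff_right scaleR_axis_real)
  next
    have "((\<lambda>u. (u *\<^sub>R q, axis j s - axis i s, 0::real)) \<longlongrightarrow> (0 *\<^sub>R q, axis j s - axis i s, 0)) (at_right 0)"
      by (intro tendsto_intros)
    then show "((\<lambda>u. (u *\<^sub>R q, axis j s - axis i s, 0::real)) \<longlongrightarrow> (0, axis j s - axis i s, 0)) (at_right 0)"
      by simp
  qed
qed

lemma recession_path:
  assumes "(i, j) \<in> (graph_edges Q)\<^sup>*"
  shows "(0, axis j s - axis i s, 0) \<in> recession_directions C"
  using assms
proof induction
  case base
  then show ?case
    using recession_directions_0[of C] by (simp add: zero_prod_def)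
next
  case (step j n)
  then show ?case
    using recession_directions_add[OF step.IH recession_edge[OF step.hyps(2), of s]] by simp
qed

text \<open>
  Moving every entry of \<open>v\<close> along a path to one fixed vertex \<open>i\<close> of the component collects the total 0
  there.
\<close>

lemma recession_balanced:
  assumes l: "l \<in> {1..k}" and v: "\<And>i. i \<notin> V l \<Longrightarrow> v $ i = 0" and "(\<Sum>i\<in>UNIV. v $ i) = 0"
  shows "(0, v, 0) \<in> recession_directions C"
proof -
  obtain i where i: "i \<in> V l"
    using V_nonempty[OF l] by blast
  have "(\<Sum>j\<in>V l. v $ j) = 0"
    using assms(3) v sum.mono_neutral_left[of UNIV "V l" "\<lambda>j. v $ j"] by auto
  then have "(\<Sum>j\<in>V l. if n = i then v $ j else 0) = 0" for n
    by (cases "n = i") simp_all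
  then have "v = (\<Sum>j\<in>V l. axis j (v $ j) - axis i (v $ j))"
    using v by (auto simp: vec_eq_iff axis_def sum_subtractf)
  then have "(0, v, 0) = (\<Sum>j\<in>V l. (0, axis j (v $ j) - axis i (v $ j), 0::real))"
    by (simp add: prod_eq_iff fst_sum snd_sum)
  also have "\<dots> \<in> recession_directions C"
    using V_connected[OF l i] by (intro recession_directions_sum recession_path)
  finally show ?thesis .
qed

text \<open>
  The hypothesis says that \<open>\<tau>\<close> bounds the perspective at weight 0, the recession function of \<open>f\<close>, at the
  sum of the entries of \<open>v\<close>. Concentrating this sum in one coordinate gives a limit of scaled points
  of the mixed-binary set; the rest of \<open>v\<close> is balanced.
\<close>

lemma recession_asymptotic:
  assumes l: "l \<in> {1..k}" and v: "\<And>i. i \<notin> V l \<Longrightarrow> v $ i = 0"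
    and \<tau>: "\<And>a b. (a, b) \<in> affine_minorants f \<Longrightarrow> a * (\<Sum>i\<in>UNIV. v $ i) \<le> \<tau>"
  shows "(0, v, \<tau>) \<in> recession_directions C"
proof -
  define s where "s = (\<Sum>i\<in>UNIV. v $ i)"
  obtain i where i: "i \<in> V l"
    using V_nonempty[OF l] by blast
  obtain q where q: "q \<in> Q" "q $ i = 1"
    using cover by blast
  have "(0, axis i s, \<tau>) \<in> recession_directions C"
  proof (rule recession_direction_limit[OF closed_closure convex_C])
    fix u :: real assume u: "0 < u"
    have "a * s + b * u \<le> \<tau>" if ab: "(a, b) \<in> affine_minorants f" for a b
    proof -
      have "b * u \<le> 0"
        using affine_minorant_at_0[OF f_0 ab] u by (simp add: mult_nonpos_nonneg)
      then show ?thesis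
        using \<tau>[OF ab] by (simp add: s_def)
    qed
    then have "u * f (s / u) \<le> \<tau>"
      using perspective_le_iff_pos[OF convex_f u] by auto
    then have "f (s / u) \<le> \<tau> / u"
      using u by (simp add: field_simps)
    then show "(1 / u) *\<^sub>R (u *\<^sub>R q, axis i s, \<tau>) \<in> C"
      using u axis_mem_C[OF q] by (simp add: scaleR_axis_real)
  next
    have "((\<lambda>u. (u *\<^sub>R q, axis i s, \<tau>)) \<longlongrightarrow> (0 *\<^sub>R q, axis i s, \<tau>)) (at_right 0)"
      by (intro tendsto_intros)
    then show "((\<lambda>u. (u *\<^sub>R q, axis i s, \<tau>)) \<longlongrightarrow> (0, axis i s, \<tau>)) (at_right 0)"
      by simp
  qed
  moreover have "(0, v - axis i s, 0) \<in> recession_directions C"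
    using i v by (intro recession_balanced[OF l]) (auto simp: axis_def s_def sum_subtractf)
  ultimately show ?thesis
    using recession_directions_add by fastforce
qed

text \<open>
  At a nonzero member of \<open>Q\<^sub>l\<close> the sum \<open>s\<close> can be placed in one coordinate of its support. Since
  \<open>s\<close> does not vary, the value \<open>f s\<close> survives convex combinations. At 0 the construction would fail,
  as \<open>\<beta>\<close> is then 0.
\<close>

lemma hull_point_lift:
  assumes l: "l \<in> {1..k}" and q: "q \<in> convex hull (S l - {0})"
  obtains \<beta> where "\<And>i. i \<notin> V l \<Longrightarrow> \<beta> $ i = 0" "(\<Sum>i\<in>UNIV. \<beta> $ i) = s" "(q, \<beta>, f s) \<in> C"
proof -
  define T where
    "T = {q. \<exists>\<beta>. (\<forall>i. i \<notin> V l \<longrightarrow> \<beta> $ i = 0) \<and> (\<Sum>i\<in>UNIV. \<beta> $ i) = s \<and> (q, \<beta>, f s) \<in> C}"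
  have "S l - {0} \<subseteq> T"
  proof
    fix z assume z: "z \<in> S l - {0}"
    then obtain i where i: "z $ i \<noteq> 0"
      by (auto simp: vec_eq_iff)
    with z have "z \<in> Q" "z $ i = 1" "i \<in> V l"
      using binaryD by (auto simp: restrict_support_def)
    then show "z \<in> T"
      unfolding T_def using axis_mem_C[of z i s "f s"]
      by (auto intro!: exI[of _ "axis i s"] simp: axis_def)
  qed
  moreover have "convex T"
  proof (rule convexI)
    fix x y and u v :: real
    assume "x \<in> T" "y \<in> T" and uv: "0 \<le> u" "0 \<le> v" "u + v = 1"
    then obtain \<beta> \<gamma> where
      \<beta>: "\<forall>i. i \<notin> V l \<longrightarrow> \<beta> $ i = 0" "(\<Sum>i\<in>UNIV. \<beta> $ i) = s" "(x, \<beta>, f s) \<in> C" and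
      \<gamma>: "\<forall>i. i \<notin> V l \<longrightarrow> \<gamma> $ i = 0" "(\<Sum>i\<in>UNIV. \<gamma> $ i) = s" "(y, \<gamma>, f s) \<in> C"
      by (auto simp: T_def)
    have "u * c + v * c = c" for c
      using uv(3) by (metis distrib_right mult_1)
    then show "u *\<^sub>R x + v *\<^sub>R y \<in> T"
      using \<beta> \<gamma> convexD[OF convex_C \<beta>(3) \<gamma>(3) uv]
      by (auto simp: T_def sum.distrib sum_distrib_left[symmetric] intro!: exI[of _ "u *\<^sub>R \<beta> + v *\<^sub>R \<gamma>"])
  qed
  ultimately have "q \<in> T"
    using q hull_minimal by blast
  then show ?thesis
    using that by (auto simp: T_def)
qed

text \<open>
  With effective weight \<open>W > 0\<close>, the point \<open>c\<close> is a lift of \<open>x / W\<close> whose \<open>\<beta>\<close> has the same sum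
  as \<open>v / W\<close>, and the remainder is a balanced vector plus a nonnegative amount of the last coordinate.
  With \<open>W = 0\<close> also \<open>x = 0\<close>, and the whole summand is a recession direction.
\<close>

lemma lifted_piece_decomposition:
  assumes l: "l \<in> {1..k}" and \<alpha>: "\<alpha> \<ge> 0" and x: "\<forall>r<m l. A l r \<bullet> x \<le> \<delta> l r * \<alpha>"
    and v: "\<And>i. i \<notin> V l \<Longrightarrow> v $ i = 0"
    and epi_\<alpha>: "perspective f \<alpha> (\<Sum>i\<in>UNIV. v $ i) \<le> ereal \<tau>"
    and epi_\<pi>: "\<And>\<pi>. \<pi> \<in> F l \<Longrightarrow> perspective f (\<pi> \<bullet> x) (\<Sum>i\<in>UNIV. v $ i) \<le> ereal \<tau>"
  shows "\<exists>W c d. 0 \<le> W \<and> W \<le> \<alpha> \<and> c \<in> C \<and> d \<in> recession_directions C \<and> (x, v, \<tau>) = W *\<^sub>R c + d"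
proof -
  define W where "W = Min (insert \<alpha> ((\<lambda>\<pi>. \<pi> \<bullet> x) ` F l))"
  define s where "s = (\<Sum>i\<in>UNIV. v $ i)"
  note W = scaled_hull_effective_weight[OF l \<alpha> x, folded W_def]
  have "W \<in> insert \<alpha> ((\<lambda>\<pi>. \<pi> \<bullet> x) ` F l)"
    unfolding W_def using finite_F[OF l] by (intro Min_in) auto
  then have epi: "perspective f W s \<le> ereal \<tau>"
    using epi_\<alpha> epi_\<pi> by (auto simp: s_def)
  show ?thesis
  proof (cases "W = 0")
    case True
    then have "(0, v, \<tau>) \<in> recession_directions C"
      using epi perspective_le_iff[OF convex_f f_0, of 0 s \<tau>]
      by (intro recession_asymptotic[OF l v]) (auto simp: s_def)
    then show ?thesis
      using W(3)[OF True] \<alpha> zero_mem_C by (intro exI[of _ 0] exI[of _ "(0, v, \<tau>)"]) auto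
  next
    case False
    then have pos: "W > 0" using W(1) by simp
    obtain \<beta> where \<beta>: "\<And>i. i \<notin> V l \<Longrightarrow> \<beta> $ i = 0" "(\<Sum>i\<in>UNIV. \<beta> $ i) = s / W"
        "(x /\<^sub>R W, \<beta>, f (s / W)) \<in> C"
      using hull_point_lift[OF l W(4)[OF pos], where s = "s / W"] by blast
    have le: "W * f (s / W) \<le> \<tau>"
      using epi pos by (simp add: perspective_def)
    (* The total of this vector is 0, so every minorant requires only a nonnegative last coordinate. *)
    have sum0: "(\<Sum>i\<in>UNIV. (v - W *\<^sub>R \<beta>) $ i) = 0"
      using \<beta>(2) pos by (simp add: sum_subtractf sum_distrib_left[symmetric] s_def)
    have "(0, v - W *\<^sub>R \<beta>, \<tau> - W * f (s / W)) \<in> recession_directions C"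
      using v \<beta>(1) le by (intro recession_asymptotic[OF l], unfold sum0) auto
    moreover have "(x, v, \<tau>) = W *\<^sub>R (x /\<^sub>R W, \<beta>, f (s / W)) + (0, v - W *\<^sub>R \<beta>, \<tau> - W * f (s / W))"
      using pos by simp
    ultimately show ?thesis
      using W(1,2) \<beta>(3) by blast
  qed
qed

lemma lifted_set_subset: "(\<lambda>(z, \<beta>, zh, bh, \<alpha>, th, t). (z, \<beta>, t)) ` lifted_set k V m A \<delta> F f \<subseteq> C"
proof clarify
  fix z \<beta> zh bh \<alpha> th t
  assume mem: "(z, \<beta>, zh, bh, \<alpha>, th, t) \<in> lifted_set k V m A \<delta> F f"
  then have "\<forall>l\<in>{1..k}. \<exists>W c d. 0 \<le> W \<and> W \<le> \<alpha> l \<and> c \<in> C \<and> d \<in> recession_directions C \<and>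
      (zh l, bh l, th l) = W *\<^sub>R c + d"
    by (intro ballI lifted_piece_decomposition) (auto simp: lifted_set_def)
  then obtain W c d where Wcd: "\<And>l. l \<in> {1..k} \<Longrightarrow> 0 \<le> W l \<and> W l \<le> \<alpha> l \<and> c l \<in> C \<and>
      d l \<in> recession_directions C \<and> (zh l, bh l, th l) = W l *\<^sub>R c l + d l"
    by metis
  have "(z, \<beta>, t) = (\<Sum>l=1..k. (zh l, bh l, th l))"
    using mem by (simp add: lifted_set_def prod_eq_iff fst_sum snd_sum)
  also have "\<dots> = (\<Sum>l=1..k. W l *\<^sub>R c l + d l)"
    using Wcd by (intro sum.cong) auto
  also have "\<dots> \<in> C"
  proof (rule subconvex_combination_plus_recession[OF convex_C zero_mem_C])
    have "sum W {1..k} \<le> sum \<alpha> {1..k}"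
      using Wcd by (intro sum_mono) auto
    then show "sum W {1..k} \<le> 1"
      using mem by (simp add: lifted_set_def)
  qed (use Wcd in auto)
  finally show "(z, \<beta>, t) \<in> C" .
qed

section \<open>The projection of the lifted set is closed and convex\<close>

text \<open>
  The lifted set with \<open>bh\<close> eliminated and the perspectives expanded into affine minorants, so that all
  conditions are linear in the variables.
\<close>

definition affine_lift ::
    "real^'p \<Rightarrow> real^'p \<Rightarrow> real \<Rightarrow> (nat \<Rightarrow> real^'p) \<Rightarrow> (nat \<Rightarrow> real) \<Rightarrow> (nat \<Rightarrow> real) \<Rightarrow> bool" where
  "affine_lift z \<beta> t zh \<alpha> th \<longleftrightarrow>
     z \<in> cbox 0 1 \<and> (\<forall>l\<in>{1..k}. zh l \<in> cbox 0 1 \<and> 0 \<le> \<alpha> l) \<and>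
     (\<Sum>l=1..k. \<alpha> l) = 1 \<and> t = (\<Sum>l=1..k. th l) \<and> z = (\<Sum>l=1..k. zh l) \<and>
     (\<forall>l\<in>{1..k}. (\<forall>r<m l. A l r \<bullet> zh l \<le> \<delta> l r * \<alpha> l) \<and>
        (\<forall>(a, b)\<in>affine_minorants f. a * (\<Sum>i\<in>V l. \<beta> $ i) + b * \<alpha> l \<le> th l \<and>
           (\<forall>\<pi>\<in>F l. a * (\<Sum>i\<in>V l. \<beta> $ i) + b * (\<pi> \<bullet> zh l) \<le> th l)))"

lemma lifted_set_block_iff:
  "(z, \<beta>, zh, (\<lambda>l. block l \<beta>), \<alpha>, th, t) \<in> lifted_set k V m A \<delta> F f \<longleftrightarrow> affine_lift z \<beta> t zh \<alpha> th"
proof -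
  have eq: "perspective f (\<alpha> l) s \<le> ereal (th l) \<and>
        (\<forall>\<pi>\<in>F l. perspective f (\<pi> \<bullet> zh l) s \<le> ereal (th l)) \<longleftrightarrow>
      (\<forall>(a, b)\<in>affine_minorants f. a * s + b * \<alpha> l \<le> th l \<and> (\<forall>\<pi>\<in>F l. a * s + b * (\<pi> \<bullet> zh l) \<le> th l))"
    if "l \<in> {1..k}" "0 \<le> \<alpha> l" "\<forall>r<m l. A l r \<bullet> zh l \<le> \<delta> l r * \<alpha> l" for l s
    using scaled_hull_inner_nonneg[OF that] that(2)
    by (simp add: perspective_le_iff[OF convex_f f_0] split_beta) blast
  show ?thesis
  proof (cases "\<forall>l\<in>{1..k}. 0 \<le> \<alpha> l \<and> (\<forall>r<m l. A l r \<bullet> zh l \<le> \<delta> l r * \<alpha> l)")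
    case True
    have "(\<forall>i. i \<notin> V l \<longrightarrow> block l \<beta> $ i = 0) \<and>
        (\<forall>r<m l. A l r \<bullet> zh l \<le> \<delta> l r * \<alpha> l) \<and>
        perspective f (\<alpha> l) (\<Sum>i\<in>V l. \<beta> $ i) \<le> ereal (th l) \<and>
        (\<forall>\<pi>\<in>F l. perspective f (\<pi> \<bullet> zh l) (\<Sum>i\<in>V l. \<beta> $ i) \<le> ereal (th l)) \<longleftrightarrow>
      (\<forall>r<m l. A l r \<bullet> zh l \<le> \<delta> l r * \<alpha> l) \<and>
        (\<forall>(a, b)\<in>affine_minorants f. a * (\<Sum>i\<in>V l. \<beta> $ i) + b * \<alpha> l \<le> th l \<and>
           (\<forall>\<pi>\<in>F l. a * (\<Sum>i\<in>V l. \<beta> $ i) + b * (\<pi> \<bullet> zh l) \<le> th l))" (is "?P l \<longleftrightarrow> ?R l")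
      if l: "l \<in> {1..k}" for l
      using eq[OF l] True l by (simp add: block_def)
    then have inner: "(\<forall>l\<in>{1..k}. ?P l) \<longleftrightarrow> (\<forall>l\<in>{1..k}. ?R l)"
      by (intro ball_cong refl)
    show ?thesis
      unfolding lifted_set_def affine_lift_def mem_Collect_eq prod.case sum_block sum_blocks inner
      by blast
  next
    case False
    then show ?thesis
      unfolding lifted_set_def affine_lift_def by blast
  qed
qed

lemma affine_liftD:
  assumes "affine_lift z \<beta> t zh \<alpha> th" "l \<in> {1..k}" "(a, b) \<in> affine_minorants f"
  shows "a * (\<Sum>i\<in>V l. \<beta> $ i) + b * \<alpha> l \<le> th l"
    and "\<pi> \<in> F l \<Longrightarrow> a * (\<Sum>i\<in>V l. \<beta> $ i) + b * (\<pi> \<bullet> zh l) \<le> th l"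
  using assms unfolding affine_lift_def by blast+

lemma mem_projection_iff:
  "(z, \<beta>, t) \<in> (\<lambda>(z, \<beta>, zh, bh, \<alpha>, th, t). (z, \<beta>, t)) ` lifted_set k V m A \<delta> F f \<longleftrightarrow>
    (\<exists>zh \<alpha> th. affine_lift z \<beta> t zh \<alpha> th)"
proof
  assume "(z, \<beta>, t) \<in> (\<lambda>(z, \<beta>, zh, bh, \<alpha>, th, t). (z, \<beta>, t)) ` lifted_set k V m A \<delta> F f"
  then obtain zh bh \<alpha> th where mem: "(z, \<beta>, zh, bh, \<alpha>, th, t) \<in> lifted_set k V m A \<delta> F f"
    by auto
  then have "bh l = block l \<beta>" if "l \<in> {1..k}" for l
    using that by (intro supported_sum_eq_block) (auto simp: lifted_set_def)
  then have "(z, \<beta>, zh, (\<lambda>l. block l \<beta>), \<alpha>, th, t) \<in> lifted_set k V m A \<delta> F f"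
    using mem by (auto simp: lifted_set_def sum_blocks)
  then show "\<exists>zh \<alpha> th. affine_lift z \<beta> t zh \<alpha> th"
    using lifted_set_block_iff by blast
next
  assume "\<exists>zh \<alpha> th. affine_lift z \<beta> t zh \<alpha> th"
  then show "(z, \<beta>, t) \<in> (\<lambda>(z, \<beta>, zh, bh, \<alpha>, th, t). (z, \<beta>, t)) ` lifted_set k V m A \<delta> F f"
    using lifted_set_block_iff by force
qed

definition projection :: "((real^'p) \<times> (real^'p) \<times> real) set" where
  "projection = {(z, \<beta>, t). \<exists>zh \<alpha> th. affine_lift z \<beta> t zh \<alpha> th}"

text \<open>
  A point with \<open>z \<in> Q\<^sub>l\<close> is lifted by giving the full weight to \<open>l\<close>. If \<open>z \<noteq> 0\<close>, the constraints
  at \<open>\<pi> \<bullet> z \<ge> 1\<close> are weaker than the one at weight 1; if \<open>z = 0\<close>, then \<open>\<beta> = 0\<close>.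
\<close>

lemma mixed_binary_set_subset_projection: "mixed_binary_set Q f \<subseteq> projection"
proof clarify
  fix z \<beta> t assume "(z, \<beta>, t) \<in> mixed_binary_set Q f"
  then have z: "z \<in> Q" and t: "f (\<Sum>i\<in>UNIV. \<beta> $ i) \<le> t" and \<beta>: "\<And>i. \<beta> $ i * (1 - z $ i) = 0"
    by (auto simp: mixed_binary_set_def)
  obtain l where l: "l \<in> {1..k}" "z \<in> S l"
    using S_cover[OF z] by blast
  have zero: "\<beta> $ i = 0" if "z $ i = 0" for i
    using \<beta>[of i] that by simp
  define zh where "zh j = (if j = l then z else 0)" for j
  define \<alpha> where "\<alpha> j = (if j = l then 1 else 0::real)" for j
  define th where "th j = (if j = l then t else 0)" for j
  have supp: "\<beta> $ i = 0" if "i \<notin> V l" for i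
    using zero l(2) that by (auto simp: restrict_support_def)
  have sum_V: "(\<Sum>i\<in>V j. \<beta> $ i) = (if j = l then \<Sum>i\<in>UNIV. \<beta> $ i else 0)" if "j \<in> {1..k}" for j
  proof (cases "j = l")
    case True
    then show ?thesis
      using sum.mono_neutral_left[of UNIV "V l" "\<lambda>i. \<beta> $ i"] supp by auto
  next
    case False
    then have "\<beta> $ i = 0" if "i \<in> V j" for i
      using mem_V_iff[OF l(1) _ \<open>j \<in> {1..k}\<close>] supp that by blast
    then show ?thesis
      using False by simp
  qed
  have minorant: "a * (\<Sum>i\<in>UNIV. \<beta> $ i) + b \<le> t" if "(a, b) \<in> affine_minorants f" for a b
    using that t by (auto simp: affine_minorants_def intro: order_trans)
  have minorant_\<pi>: "a * (\<Sum>i\<in>UNIV. \<beta> $ i) + b * (\<pi> \<bullet> z) \<le> t"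
    if ab: "(a, b) \<in> affine_minorants f" and \<pi>: "\<pi> \<in> F l" for a b \<pi>
  proof (cases "z = 0")
    case True
    then have "\<beta> = 0"
      using zero by (simp add: vec_eq_iff)
    then show ?thesis
      using True t f_0 by simp
  next
    case False
    then have "z \<in> convex hull (S l - {0})"
      using l(2) by (intro hull_inc) simp
    then have "1 \<le> \<pi> \<bullet> z"
      using hull_nonzero[OF l(1)] \<pi> by blast
    then have "b * (\<pi> \<bullet> z) \<le> b * 1"
      using affine_minorant_at_0[OF f_0 ab] by (rule mult_left_mono_neg)
    then show ?thesis
      using minorant[OF ab] by simp
  qed
  have "z \<in> convex hull (S l)"
    using l(2) by (rule hull_inc)
  then have A: "A l r \<bullet> z \<le> \<delta> l r" if "r < m l" for r
    using hull[OF l(1)] that by auto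
  have zbox: "z \<in> cbox 0 1" "0 \<in> cbox 0 (1::real^'p)"
    using subsetD[OF S_subset_cbox l(2)] by (simp_all add: mem_box_cart)
  have "affine_lift z \<beta> t zh \<alpha> th"
    unfolding affine_lift_def
    using zbox l(1) A minorant minorant_\<pi> sum_V by (auto simp: zh_def \<alpha>_def th_def)
  then show "(z, \<beta>, t) \<in> projection"
    by (auto simp: projection_def)
qed

lemma convex_projection: "convex projection"
proof (rule convexI, clarify)
  fix z \<beta> t z' \<beta>' t' and u v :: real
  assume "(z, \<beta>, t) \<in> projection" "(z', \<beta>', t') \<in> projection" and uv: "0 \<le> u" "0 \<le> v" "u + v = 1"
  then obtain zh \<alpha> th zh' \<alpha>' th' where
    *: "affine_lift z \<beta> t zh \<alpha> th" and **: "affine_lift z' \<beta>' t' zh' \<alpha>' th'"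
    by (auto simp: projection_def)
  have combine: "u * x + v * x' \<le> u * y + v * y'" if "x \<le> y" "x' \<le> y'" for x x' y y'
    using that uv by (intro add_mono mult_left_mono)
  have "affine_lift (u *\<^sub>R z + v *\<^sub>R z') (u *\<^sub>R \<beta> + v *\<^sub>R \<beta>') (u * t + v * t')
      (\<lambda>l. u *\<^sub>R zh l + v *\<^sub>R zh' l) (\<lambda>l. u * \<alpha> l + v * \<alpha>' l) (\<lambda>l. u * th l + v * th' l)"
    unfolding affine_lift_def
  proof (intro conjI ballI allI impI, goal_cases)
    case 1
    then show ?case
      using * ** uv by (intro convexD[OF convex_box(1)]) (auto simp: affine_lift_def)
  next
    case (2 l)
    then show ?case
      using * ** uv by (intro convexD[OF convex_box(1)]) (auto simp: affine_lift_def)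
  next
    case (3 l)
    then show ?case
      using * ** uv by (auto simp: affine_lift_def)
  next
    case 4
    then show ?case
      using * ** uv by (simp add: affine_lift_def sum.distrib sum_distrib_left[symmetric])
  next
    case 5
    then show ?case
      using * ** by (simp add: affine_lift_def sum.distrib sum_distrib_left)
  next
    case 6
    then show ?case
      using * ** by (simp add: affine_lift_def sum.distrib scaleR_right.sum)
  next
    case (7 l r)
    then have "A l r \<bullet> zh l \<le> \<delta> l r * \<alpha> l" "A l r \<bullet> zh' l \<le> \<delta> l r * \<alpha>' l"
      using * ** by (auto simp: affine_lift_def)
    from combine[OF this] show ?case
      by (simp add: inner_add_right algebra_simps)
  next
    case (8 l ab)
    obtain a b where ab: "ab = (a, b)"
      by force
    have mem: "l \<in> {1..k}" "(a, b) \<in> affine_minorants f"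
      using 8 ab by auto
    note \<alpha> = combine[OF affine_liftD(1)[OF * mem] affine_liftD(1)[OF ** mem]]
    note \<pi> = combine[OF affine_liftD(2)[OF * mem] affine_liftD(2)[OF ** mem]]
    show ?case
      using \<alpha> \<pi> by (simp add: ab inner_add_right sum.distrib sum_distrib_left[symmetric] algebra_simps)
  qed
  then show "u *\<^sub>R (z, \<beta>, t) + v *\<^sub>R (z', \<beta>', t') \<in> projection"
    by (auto simp: projection_def)
qed

text \<open>
  The minorant \<open>a y\<close> of slope \<open>a\<close> bounds every \<open>th l\<close> from below. As the \<open>th l\<close> add up to \<open>t\<close>, these
  lower bounds also bound each of them from above.
\<close>

lemma affine_lift_bounds:
  assumes "affine_lift z \<beta> t zh \<alpha> th" "l \<in> {1..k}" "\<And>y. a * y \<le> f y"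
  shows "\<alpha> l \<in> {0..1}"
    and "th l \<in> {a * (\<Sum>i\<in>V l. \<beta> $ i)..t - a * (\<Sum>i\<in>UNIV. \<beta> $ i) + a * (\<Sum>i\<in>V l. \<beta> $ i)}"
proof -
  have sum1: "(\<Sum>l=1..k. \<alpha> l) = 1" and nonneg: "\<And>j. j \<in> {1..k} \<Longrightarrow> 0 \<le> \<alpha> j"
    using assms(1) by (auto simp: affine_lift_def)
  show "\<alpha> l \<in> {0..1}"
    using member_le_sum[of l "{1..k}" \<alpha>] nonneg assms(2) sum1 by auto
  have "(a, 0) \<in> affine_minorants f"
    using assms(3) by (simp add: affine_minorants_def)
  then have ge: "a * (\<Sum>i\<in>V j. \<beta> $ i) \<le> th j" if "j \<in> {1..k}" for j
    using affine_liftD(1)[OF assms(1) that \<open>(a, 0) \<in> affine_minorants f\<close>] by simp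
  have "(\<Sum>j=1..k. \<Sum>i\<in>V j. \<beta> $ i) = (\<Sum>j=1..k. \<Sum>i\<in>UNIV. block j \<beta> $ i)"
    by (simp add: sum_block)
  also have "\<dots> = (\<Sum>i\<in>UNIV. (\<Sum>j=1..k. block j \<beta>) $ i)"
    unfolding sum_component by (rule sum.swap)
  also have "\<dots> = (\<Sum>i\<in>UNIV. \<beta> $ i)"
    unfolding sum_blocks ..
  finally have total: "(\<Sum>j=1..k. \<Sum>i\<in>V j. \<beta> $ i) = (\<Sum>i\<in>UNIV. \<beta> $ i)" .
  have "th l - a * (\<Sum>i\<in>V l. \<beta> $ i) \<le> (\<Sum>j=1..k. th j - a * (\<Sum>i\<in>V j. \<beta> $ i))"
    using member_le_sum[of l "{1..k}" "\<lambda>j. th j - a * (\<Sum>i\<in>V j. \<beta> $ i)"] ge assms(2) by auto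
  also have "\<dots> = t - a * (\<Sum>i\<in>UNIV. \<beta> $ i)"
    using assms(1) by (simp add: affine_lift_def sum_subtractf sum_distrib_left[symmetric] total)
  finally show "th l \<in> {a * (\<Sum>i\<in>V l. \<beta> $ i)..t - a * (\<Sum>i\<in>UNIV. \<beta> $ i) + a * (\<Sum>i\<in>V l. \<beta> $ i)}"
    using ge[OF assms(2)] by simp
qed

text \<open>
  The lifts of a convergent sequence are bounded, so they converge along a subsequence, and the
  linear conditions pass to the limit.
\<close>

lemma closed_projection: "closed projection"
  unfolding closed_sequential_limits
proof clarify
  fix w z \<beta> t assume w: "\<forall>n. w n \<in> projection" "w \<longlonglongrightarrow> (z, \<beta>, t)"
  define zn \<beta>n tn where "zn n = fst (w n)" and "\<beta>n n = fst (snd (w n))" and "tn n = snd (snd (w n))" for n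
  have lim: "zn \<longlonglongrightarrow> z" "\<beta>n \<longlonglongrightarrow> \<beta>" "tn \<longlonglongrightarrow> t"
    using tendsto_fst[OF w(2)] tendsto_fst[OF tendsto_snd[OF w(2)]] tendsto_snd[OF tendsto_snd[OF w(2)]]
    by (simp_all add: zn_def[abs_def] \<beta>n_def[abs_def] tn_def[abs_def])
  have "\<forall>n. \<exists>zh \<alpha> th. affine_lift (zn n) (\<beta>n n) (tn n) zh \<alpha> th"
    using w(1) by (auto simp: projection_def zn_def \<beta>n_def tn_def split_beta)
  then obtain zh \<alpha> th where lift: "\<And>n. affine_lift (zn n) (\<beta>n n) (tn n) (zh n) (\<alpha> n) (th n)"
    by metis
  \<comment> \<open>The slope of a supporting line at 0, where \<open>f\<close> vanishes.\<close>
  obtain a where a: "\<And>y. a * y \<le> f y"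
    using supporting_line[OF convex_f, of 0] f_0 by auto
  have bdd: "bounded (range (\<lambda>n. (zh n l, \<alpha> n l, th n l)))" if l: "l \<in> {1..k}" for l
  proof -
    define lo hi where "lo n = a * (\<Sum>i\<in>V l. \<beta>n n $ i)"
      and "hi n = tn n - a * (\<Sum>i\<in>UNIV. \<beta>n n $ i) + a * (\<Sum>i\<in>V l. \<beta>n n $ i)" for n
    have "lo \<longlonglongrightarrow> a * (\<Sum>i\<in>V l. \<beta> $ i)"
      unfolding lo_def by (intro tendsto_intros lim)
    moreover have "hi \<longlonglongrightarrow> t - a * (\<Sum>i\<in>UNIV. \<beta> $ i) + a * (\<Sum>i\<in>V l. \<beta> $ i)"
      unfolding hi_def by (intro tendsto_intros lim)
    ultimately have "bounded (range lo)" "bounded (range hi)"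
      using convergent_imp_bounded by auto
    then obtain L H where LH: "\<And>n. \<bar>lo n\<bar> \<le> L" "\<And>n. \<bar>hi n\<bar> \<le> H"
      by (auto simp: bounded_iff)
    have "(zh n l, \<alpha> n l, th n l) \<in> cbox 0 1 \<times> {0..1} \<times> {- L..H}" for n
    proof -
      have "zh n l \<in> cbox 0 1"
        using lift[of n] l unfolding affine_lift_def by blast
      moreover have "lo n \<le> th n l" "th n l \<le> hi n"
        using affine_lift_bounds(2)[OF lift l a, of n] by (simp_all add: lo_def hi_def)
      then have "- L \<le> th n l" "th n l \<le> H"
        using LH[of n] by linarith+
      ultimately show ?thesis
        using affine_lift_bounds(1)[OF lift l a, of n] by simp
    qed
    then have "range (\<lambda>n. (zh n l, \<alpha> n l, th n l)) \<subseteq> cbox 0 1 \<times> {0..1} \<times> {- L..H}"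
      by (rule image_subsetI)
    moreover have "bounded (cbox 0 (1::real^'p) \<times> {0..1::real} \<times> {- L..H})"
      by (intro bounded_Times bounded_cbox bounded_closed_interval)
    ultimately show ?thesis
      by (rule bounded_subset[rotated])
  qed
  obtain r y where r: "strict_mono r"
    and y: "\<forall>l\<in>{1..k}. (\<lambda>n. (zh (r n) l, \<alpha> (r n) l, th (r n) l)) \<longlonglongrightarrow> y l"
    using finite_family_convergent_subsequence[of "{1..k}" "\<lambda>n l. (zh n l, \<alpha> n l, th n l)"] bdd by blast
  define zh' \<alpha>' th' where "zh' l = fst (y l)" and "\<alpha>' l = fst (snd (y l))" and "th' l = snd (snd (y l))" for l
  have lim_zh: "(\<lambda>n. zh (r n) l) \<longlonglongrightarrow> zh' l"
    and lim_\<alpha>: "(\<lambda>n. \<alpha> (r n) l) \<longlonglongrightarrow> \<alpha>' l"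
    and lim_th: "(\<lambda>n. th (r n) l) \<longlonglongrightarrow> th' l" if "l \<in> {1..k}" for l
    using y that tendsto_fst[of _ "y l"] tendsto_fst[OF tendsto_snd[of _ "y l"]]
      tendsto_snd[OF tendsto_snd[of _ "y l"]]
    by (force simp: zh'_def \<alpha>'_def th'_def)+
  have lim_r: "(\<lambda>n. zn (r n)) \<longlonglongrightarrow> z" "(\<lambda>n. \<beta>n (r n)) \<longlonglongrightarrow> \<beta>" "(\<lambda>n. tn (r n)) \<longlonglongrightarrow> t"
    using lim LIMSEQ_subseq_LIMSEQ[OF _ r] by (auto simp: o_def)
  have lift_r: "zn (r n) \<in> cbox 0 1" "l \<in> {1..k} \<Longrightarrow> zh (r n) l \<in> cbox 0 1" "l \<in> {1..k} \<Longrightarrow> 0 \<le> \<alpha> (r n) l"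
      "(\<Sum>l=1..k. \<alpha> (r n) l) = 1" "(\<Sum>l=1..k. th (r n) l) = tn (r n)" "(\<Sum>l=1..k. zh (r n) l) = zn (r n)"
      "l \<in> {1..k} \<Longrightarrow> i < m l \<Longrightarrow> A l i \<bullet> zh (r n) l \<le> \<delta> l i * \<alpha> (r n) l" for n l i
    using lift[of "r n"] unfolding affine_lift_def by auto
  have "affine_lift z \<beta> t zh' \<alpha>' th'"
    unfolding affine_lift_def
  proof (intro conjI ballI allI impI, goal_cases)
    case 1
    show ?case
      by (rule closed_sequentially[OF closed_cbox _ lim_r(1)]) (rule lift_r(1))
  next
    case (2 l)
    show ?case
      by (rule closed_sequentially[OF closed_cbox _ lim_zh[OF 2]]) (rule lift_r(2)[OF 2])
  next
    case (3 l)
    show ?case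
      by (rule LIMSEQ_le_const[OF lim_\<alpha>[OF 3]]) (use lift_r(3)[OF 3] in blast)
  next
    case 4
    have "(\<lambda>n. \<Sum>l=1..k. \<alpha> (r n) l) \<longlonglongrightarrow> (\<Sum>l=1..k. \<alpha>' l)"
      by (intro tendsto_sum lim_\<alpha>)
    then show ?case
      by (simp add: lift_r(4) LIMSEQ_const_iff)
  next
    case 5
    have "(\<lambda>n. \<Sum>l=1..k. th (r n) l) \<longlonglongrightarrow> (\<Sum>l=1..k. th' l)"
      by (intro tendsto_sum lim_th)
    then show ?case
      using LIMSEQ_unique[OF lim_r(3)] by (simp add: lift_r(5))
  next
    case 6
    have "(\<lambda>n. \<Sum>l=1..k. zh (r n) l) \<longlonglongrightarrow> (\<Sum>l=1..k. zh' l)"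
      by (intro tendsto_sum lim_zh)
    then show ?case
      using LIMSEQ_unique[OF lim_r(1)] by (simp add: lift_r(6))
  next
    case (7 l i)
    show ?case
    proof (rule LIMSEQ_le)
      show "(\<lambda>n. A l i \<bullet> zh (r n) l) \<longlonglongrightarrow> A l i \<bullet> zh' l"
        by (intro tendsto_intros lim_zh 7)
      show "(\<lambda>n. \<delta> l i * \<alpha> (r n) l) \<longlonglongrightarrow> \<delta> l i * \<alpha>' l"
        by (intro tendsto_intros lim_\<alpha> 7)
    qed (use lift_r(7)[OF 7] in blast)
  next
    case (8 l ab)
    obtain a b where ab: "ab = (a, b)"
      by force
    have mem: "l \<in> {1..k}" "(a, b) \<in> affine_minorants f"
      using 8 ab by auto
    have "a * (\<Sum>i\<in>V l. \<beta> $ i) + b * \<alpha>' l \<le> th' l"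
    proof (rule LIMSEQ_le)
      show "(\<lambda>n. a * (\<Sum>i\<in>V l. \<beta>n (r n) $ i) + b * \<alpha> (r n) l) \<longlonglongrightarrow> a * (\<Sum>i\<in>V l. \<beta> $ i) + b * \<alpha>' l"
        by (intro tendsto_intros lim_\<alpha> lim_r 8)
      show "(\<lambda>n. th (r n) l) \<longlonglongrightarrow> th' l"
        by (intro lim_th 8)
    qed (use affine_liftD(1)[OF lift mem] in blast)
    moreover have "a * (\<Sum>i\<in>V l. \<beta> $ i) + b * (\<pi> \<bullet> zh' l) \<le> th' l" if "\<pi> \<in> F l" for \<pi>
    proof (rule LIMSEQ_le)
      show "(\<lambda>n. a * (\<Sum>i\<in>V l. \<beta>n (r n) $ i) + b * (\<pi> \<bullet> zh (r n) l)) \<longlonglongrightarrow>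
          a * (\<Sum>i\<in>V l. \<beta> $ i) + b * (\<pi> \<bullet> zh' l)"
        by (intro tendsto_intros lim_zh lim_r 8)
      show "(\<lambda>n. th (r n) l) \<longlonglongrightarrow> th' l"
        by (intro lim_th 8)
    qed (use affine_liftD(2)[OF lift mem that] in blast)
    ultimately show ?case
      by (simp add: ab)
  qed
  then show "(z, \<beta>, t) \<in> projection"
    by (auto simp: projection_def)
qed

section \<open>The extended formulation\<close>

theorem closure_convex_hull_eq_projection:
  "C = (\<lambda>(z, \<beta>, zh, bh, \<alpha>, th, t). (z, \<beta>, t)) ` lifted_set k V m A \<delta> F f" (is "_ = ?P")
proof
  have "x \<in> projection \<longleftrightarrow> x \<in> ?P" for x
    by (cases x) (simp only: projection_def mem_Collect_eq prod.case mem_projection_iff)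
  then have "projection = ?P"
    by (rule set_eqI)
  then show "C \<subseteq> ?P"
    using closure_minimal[OF _ closed_projection]
      hull_minimal[of _ projection convex, OF mixed_binary_set_subset_projection convex_projection]
    by blast
qed (rule lifted_set_subset)

end

theorem theorem2:
  fixes Q :: "(real^'p::finite) set"
    and f :: "real \<Rightarrow> real"
    and k :: nat
    and V :: "nat \<Rightarrow> 'p set"
    and m :: "nat \<Rightarrow> nat"
    and A :: "nat \<Rightarrow> nat \<Rightarrow> real^'p"
    and \<delta> :: "nat \<Rightarrow> nat \<Rightarrow> real"
    and F :: "nat \<Rightarrow> (real^'p) set"
  assumes "Q \<subseteq> binary_vectors"
    and "\<And>i. \<exists>z\<in>Q. z $ i = 1"
    and "convex_on UNIV f"
    and "f 0 = 0"
    and "bij_betw V {1..k} (graph_components Q)"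
    and "\<And>l. l \<in> {1..k} \<Longrightarrow>
           convex hull (restrict_support Q (V l)) = {z. \<forall>r<m l. A l r \<bullet> z \<le> \<delta> l r}"
    and "\<And>l. l \<in> {1..k} \<Longrightarrow> finite (F l)"
    and "\<And>l. l \<in> {1..k} \<Longrightarrow>
           convex hull (restrict_support Q (V l) - {0}) =
             convex hull (restrict_support Q (V l)) \<inter> {z. \<forall>\<pi>\<in>F l. \<pi> \<bullet> z \<ge> 1}"
    and "\<And>l. l \<in> {1..k} \<Longrightarrow> 0 \<in> restrict_support Q (V l)"
    and "\<And>l. l \<in> {1..k} \<Longrightarrow> F l \<noteq> {}"
  shows "closure (convex hull (mixed_binary_set Q f)) =
           (\<lambda>(z, \<beta>, zh, bh, \<alpha>, th, t). (z, \<beta>, t)) ` lifted_set k V m A \<delta> F f"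
proof -
  interpret component_decomposition Q f k V m A \<delta> F
    by unfold_locales (use assms in auto)
  show ?thesis
    by (rule closure_convex_hull_eq_projection)
qed

end
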